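(* Let $L$ be a vector space over $K$, let $\alpha:L\to L$ be a linear map, and let $\pi_1,\pi_2\in\mathbb C_\alpha^2(L,L)$. Then $(L,\pi_1,\pi_2,\alpha)$ is a compatible Hom-Leibniz algebra if and only if $(\pi_1,\pi_2)$ is a Maurer-Cartan element of the bi-differential graded Lie algebra $(\mathbb C_\alpha^*(L,L),[\cdot,\cdot]_B,\delta_1=0,\delta_2=0)$.
   Context: $K$ is a field of characteristic $0$. Hom-Leibniz algebra: a triple $(L,[\cdot,\cdot],\alpha)$ with $L$ a $K$-vector space, $[\cdot,\cdot]:L\otimes L\to L$ and $\alpha:L\to L$ linear, such that $[\alpha(x),[y,z]]=[[x,y],\alpha(z)]+[\alpha(y),[x,z]]$ for all $x,y,z\in L$. All Hom-Leibniz algebras are assumed multiplicative: $\alpha([x,y])=[\alpha(x),\alpha(y)]$. Compatible Hom-Leibniz algebra: a quadruple $(L,[\cdot,\cdot],\{\cdot,\cdot\},\alpha)$ such that $(L,[\cdot,\cdot],\alpha)$ and $(L,\{\cdot,\cdot\},\alpha)$ are Hom-Leibniz algebras and for all $x,y,z\in L$ $$[\alpha(x),\{y,z\}]+\{\alpha(x),[y,z]\}=[\{x,y\},\alpha(z)]+\{[x,y],\alpha(z)\}+[\alpha(y),\{x,z\}]+\{\alpha(y),[x,z]\}.$$ Cochains: for $n\ge1$, $\mathbb C_\alpha^n(L,L)=\{f\in \mathrm{Hom}(L^{\otimes n},L)\mid \alpha\circ f=f\circ\alpha^{\otimes n}\}$, and $\mathbb C_\alpha^*(L,L)=\bigoplus_{n\ge1}\mathbb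 C_\alpha^n(L,L)$, where elements of $\mathbb C_\alpha^n(L,L)$ have degree $n-1$. Balavoine bracket: for $P\in\mathbb C_\alpha^{p+1}(L,L)$, $Q\in\mathbb C_\alpha^{q+1}(L,L)$, $[P,Q]_B=P\circ Q-(-1)^{pq}Q\circ P$, where $P\circ Q=\sum_{k=1}^{p+1}(-1)^{(k-1)q}P\circ_kQ\in \mathbb C_\alpha^{p+q+1}(L,L)$ and $$(P\circ_kQ)(x_1,\dots,x_{p+q+1})=\sum_{\sigma\in S_{(k-1,q)}}(-1)^\sigma P\big(\alpha^q(x_{\sigma(1)}),\dots,\alpha^q(x_{\sigma(k-1)}),Q(x_{\sigma(k)},\dots,x_{\sigma(k+q-1)},x_{k+q}),\alpha^q(x_{k+q+1}),\dots,\alpha^q(x_{p+q+1})\big).$$ Here $S_{(i,n-i)}$ is the set of $\sigma\in S_n$ with $\sigma(1)<\dots<\sigma(i)$ and $\sigma(i+1)<\dots<\sigma(n)$ (only the identity if $i=0$ or $i=n$), and $(-1)^\sigma$ is the sign. It is known that $(\mathbb C_\alpha^*(L,L),[\cdot,\cdot]_B)$ is a graded Lie algebra. Bi-differential graded Lie algebra (b-dgLa): $(\mathfrak g,[\cdot,\cdot],\delta_1,\delta_2)$ such that $(\mathfrak g,[\cdot,\cdot],\delta_1)$ and $(\mathfrak g,[\cdot,\cdot],\delta_2)$ are differential graded Lie algebras (differentials of degree $+1$) and $\delta_1\delta_2+\delta_2\delta_1=0$. A Maurer-Cartan element of a differential graded Lie algebra $(\mathfrak g,[\cdot,\cdot],\delta)$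 is a degree $1$ element $x$ with $\delta x+\frac12[x,x]=0$. A Maurer-Cartan element of the b-dgLa is a pair $(\pi_1,\pi_2)$ of degree $1$ elements such that $\pi_i$ is a Maurer-Cartan element of $(\mathfrak g,[\cdot,\cdot],\delta_i)$ for $i=1,2$ and $\delta_2\pi_1+\delta_1\pi_2+[\pi_1,\pi_2]=0$. *)

theory Defs
  imports "HOL.Vector_Spaces" "HOL-Library.Function_Algebras" "HOL-Combinatorics.Permutations"
begin

locale hom_leibniz_algebra = vector_space scale
  for scale :: "'k::field_char_0 \<Rightarrow> 'v::ab_group_add \<Rightarrow> 'v" +
  fixes br :: "'v \<Rightarrow> 'v \<Rightarrow> 'v" and \<alpha> :: "'v \<Rightarrow> 'v"
  assumes linear_twist: "Vector_Spaces.linear scale scale \<alpha>"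
    and linear_left: "\<And>y. Vector_Spaces.linear scale scale (\<lambda>x. br x y)"
    and linear_right: "\<And>x. Vector_Spaces.linear scale scale (\<lambda>y. br x y)"
    and hom_leibniz: "\<And>x y z. br (\<alpha> x) (br y z) = br (br x y) (\<alpha> z) + br (\<alpha> y) (br x z)"
    and multiplicative: "\<And>x y. \<alpha> (br x y) = br (\<alpha> x) (\<alpha> y)"

locale compatible_hom_leibniz_algebra =
  A: hom_leibniz_algebra scale br1 \<alpha> + B: hom_leibniz_algebra scale br2 \<alpha>
  for scale :: "'k::field_char_0 \<Rightarrow> 'v::ab_group_add \<Rightarrow> 'v"
    and br1 br2 :: "'v \<Rightarrow> 'v \<Rightarrow> 'v" and \<alpha> :: "'v \<Rightarrow> 'v" +
  assumes compatible:
    "\<And>x y z. br1 (\<alpha> x) (br2 y z) + br2 (\<alpha> x) (br1 y z) =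
       br1 (br2 x y) (\<alpha> z) + br2 (br1 x y) (\<alpha> z) + br1 (\<alpha> y) (br2 x z) + br2 (\<alpha> y) (br1 x z)"


section \<open>(Bi-)differential graded Lie algebras and Maurer--Cartan elements\<close>

text \<open>The grading is internal: \<open>G i\<close> is the homogeneous component of degree \<open>i\<close> inside an ambient
  vector space, and the underlying space of the algebra is the sum of the components (which the
  ambient space may exceed).\<close>

locale graded_lie_algebra = vector_space scale
  for scale :: "'k::field_char_0 \<Rightarrow> 'g::ab_group_add \<Rightarrow> 'g" +
  fixes G :: "int \<Rightarrow> 'g set" and brk :: "'g \<Rightarrow> 'g \<Rightarrow> 'g"
  assumes subspace_component: "\<And>i. subspace (G i)"
    and direct_sum: "\<And>I x i. finite I \<Longrightarrow> (\<And>j. j \<in> I \<Longrightarrow> x j \<in> G j) \<Longrightarrow> (\<Sum>j\<in>I. x j) = 0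
      \<Longrightarrow> i \<in> I \<Longrightarrow> x i = 0"
    and brk_degree: "\<And>i j x y. x \<in> G i \<Longrightarrow> y \<in> G j \<Longrightarrow> brk x y \<in> G (i + j)"
    and brk_add_left: "\<And>x y z. x \<in> span (\<Union>(range G)) \<Longrightarrow> y \<in> span (\<Union>(range G))
      \<Longrightarrow> z \<in> span (\<Union>(range G)) \<Longrightarrow> brk (x + y) z = brk x z + brk y z"
    and brk_add_right: "\<And>x y z. x \<in> span (\<Union>(range G)) \<Longrightarrow> y \<in> span (\<Union>(range G))
      \<Longrightarrow> z \<in> span (\<Union>(range G)) \<Longrightarrow> brk x (y + z) = brk x y + brk x z"
    and brk_scale_left: "\<And>c x y. x \<in> span (\<Union>(range G)) \<Longrightarrow> y \<in> span (\<Union>(range G))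
      \<Longrightarrow> brk (scale c x) y = scale c (brk x y)"
    and brk_scale_right: "\<And>c x y. x \<in> span (\<Union>(range G)) \<Longrightarrow> y \<in> span (\<Union>(range G))
      \<Longrightarrow> brk x (scale c y) = scale c (brk x y)"
    and graded_antisym: "\<And>i j x y. x \<in> G i \<Longrightarrow> y \<in> G j
      \<Longrightarrow> brk x y = - scale ((-1) powi (i * j)) (brk y x)"
    and graded_jacobi: "\<And>i j l x y z. x \<in> G i \<Longrightarrow> y \<in> G j \<Longrightarrow> z \<in> G l
      \<Longrightarrow> brk x (brk y z) = brk (brk x y) z + scale ((-1) powi (i * j)) (brk y (brk x z))"

locale dg_lie_algebra = graded_lie_algebra scale G brk
  for scale :: "'k::field_char_0 \<Rightarrow> 'g::ab_group_add \<Rightarrow> 'g"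
    and G :: "int \<Rightarrow> 'g set" and brk :: "'g \<Rightarrow> 'g \<Rightarrow> 'g" +
  fixes \<delta> :: "'g \<Rightarrow> 'g"
  assumes diff_degree: "\<And>i x. x \<in> G i \<Longrightarrow> \<delta> x \<in> G (i + 1)"
    and diff_add: "\<And>x y. x \<in> span (\<Union>(range G)) \<Longrightarrow> y \<in> span (\<Union>(range G)) \<Longrightarrow> \<delta> (x + y) = \<delta> x + \<delta> y"
    and diff_scale: "\<And>c x. x \<in> span (\<Union>(range G)) \<Longrightarrow> \<delta> (scale c x) = scale c (\<delta> x)"
    and diff_diff: "\<And>x. x \<in> span (\<Union>(range G)) \<Longrightarrow> \<delta> (\<delta> x) = 0"
    and diff_brk: "\<And>i j x y. x \<in> G i \<Longrightarrow> y \<in> G j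
      \<Longrightarrow> \<delta> (brk x y) = brk (\<delta> x) y + scale ((-1) powi i) (brk x (\<delta> y))"

locale bidg_lie_algebra =
  D1: dg_lie_algebra scale G brk \<delta>1 + D2: dg_lie_algebra scale G brk \<delta>2
  for scale :: "'k::field_char_0 \<Rightarrow> 'g::ab_group_add \<Rightarrow> 'g"
    and G :: "int \<Rightarrow> 'g set" and brk :: "'g \<Rightarrow> 'g \<Rightarrow> 'g"
    and \<delta>1 \<delta>2 :: "'g \<Rightarrow> 'g" +
  assumes diff_anticommute:
    "\<And>x. x \<in> D1.span (\<Union>(range G)) \<Longrightarrow> \<delta>1 (\<delta>2 x) + \<delta>2 (\<delta>1 x) = 0"

lemma (in graded_lie_algebra) bidg_lie_algebra_zero:
  "bidg_lie_algebra scale G brk (\<lambda>_. 0) (\<lambda>_. 0)"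
proof -
  have z: "0 \<in> G i" for i
    by (rule subspace_0[OF subspace_component])
  have sp: "x \<in> span (\<Union>(range G))" if "x \<in> G i" for x i
    using that by (auto intro: span_base)
  have l: "brk 0 y = 0" if "y \<in> G j" for y j
    using brk_scale_left[of 0 y 0] sp[OF that] sp[OF z] by simp
  have r: "brk x 0 = 0" if "x \<in> G j" for x j
    using brk_scale_right[of x 0 0] sp[OF that] sp[OF z] by simp
  show ?thesis
    by unfold_locales (auto simp: z l r)
qed

text \<open>The Maurer--Cartan conditions are definitions on the data \<open>(scale, G, brk, \<delta>)\<close> outside the
  locales, so that they unfold unconditionally; they are meant for a \<open>dg_lie_algebra\<close> and a
  \<open>bidg_lie_algebra\<close>, respectively.\<close>

definition maurer_cartan ::
  "('k::field_char_0 \<Rightarrow> 'g::ab_group_add \<Rightarrow> 'g) \<Rightarrow> (int \<Rightarrow> 'g set) \<Rightarrow> ('g \<Rightarrow> 'g \<Rightarrow> 'g)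
     \<Rightarrow> ('g \<Rightarrow> 'g) \<Rightarrow> 'g \<Rightarrow> bool" where
  "maurer_cartan scale G brk \<delta> x \<longleftrightarrow> x \<in> G 1 \<and> \<delta> x + scale (1 / 2) (brk x x) = 0"

definition bidg_maurer_cartan ::
  "('k::field_char_0 \<Rightarrow> 'g::ab_group_add \<Rightarrow> 'g) \<Rightarrow> (int \<Rightarrow> 'g set) \<Rightarrow> ('g \<Rightarrow> 'g \<Rightarrow> 'g)
     \<Rightarrow> ('g \<Rightarrow> 'g) \<Rightarrow> ('g \<Rightarrow> 'g) \<Rightarrow> 'g \<times> 'g \<Rightarrow> bool" where
  "bidg_maurer_cartan scale G brk \<delta>1 \<delta>2 = (\<lambda>(\<pi>1, \<pi>2).
     maurer_cartan scale G brk \<delta>1 \<pi>1 \<and> maurer_cartan scale G brk \<delta>2 \<pi>2 \<and>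
     \<delta>2 \<pi>1 + \<delta>1 \<pi>2 + brk \<pi>1 \<pi>2 = 0)"


section \<open>Cochains\<close>

text \<open>A linear map \<open>L\<^sup>\<otimes>\<^sup>n \<rightarrow> L\<close> is encoded as an \<open>n\<close>-linear function of lists of length \<open>n\<close>, extended
  by \<open>0\<close> to lists of any other length. Cochains of all arities thus live in the single vector space
  of functions \<open>'v list \<Rightarrow> 'v\<close>, with pointwise operations, and their sum there is direct.\<close>

definition multilinear ::
  "('k::field \<Rightarrow> 'v::ab_group_add \<Rightarrow> 'v) \<Rightarrow> nat \<Rightarrow> ('v list \<Rightarrow> 'v) \<Rightarrow> bool" where
  "multilinear scale n f \<longleftrightarrow>
     (\<forall>xs i. length xs = n \<longrightarrow> i < n \<longrightarrow> Vector_Spaces.linear scale scale (\<lambda>x. f (xs[i := x])))"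

definition cochains ::
  "('k::field \<Rightarrow> 'v::ab_group_add \<Rightarrow> 'v) \<Rightarrow> ('v \<Rightarrow> 'v) \<Rightarrow> nat \<Rightarrow> ('v list \<Rightarrow> 'v) set" where
  "cochains scale \<alpha> n = {f. multilinear scale n f \<and>
     (\<forall>xs. length xs = n \<longrightarrow> \<alpha> (f xs) = f (map \<alpha> xs)) \<and>
     (\<forall>xs. length xs \<noteq> n \<longrightarrow> f xs = 0)}"

definition cochain_component ::
  "('k::field \<Rightarrow> 'v::ab_group_add \<Rightarrow> 'v) \<Rightarrow> ('v \<Rightarrow> 'v) \<Rightarrow> int \<Rightarrow> ('v list \<Rightarrow> 'v) set" where
  "cochain_component scale \<alpha> i = (if i \<ge> 0 then cochains scale \<alpha> (nat i + 1) else {0})"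

definition cochain_scale ::
  "('k \<Rightarrow> 'v \<Rightarrow> 'v) \<Rightarrow> 'k \<Rightarrow> ('v list \<Rightarrow> 'v) \<Rightarrow> ('v list \<Rightarrow> 'v)" where
  "cochain_scale scale c f = (\<lambda>xs. scale c (f xs))"


section \<open>The Balavoine bracket\<close>

definition unshuffles :: "nat \<Rightarrow> nat \<Rightarrow> (nat \<Rightarrow> nat) set" where
  "unshuffles i j = {\<sigma>. \<sigma> permutes {1..i + j} \<and>
     strict_mono_on {1..i} \<sigma> \<and> strict_mono_on {i + 1..i + j} \<sigma>}"

text \<open>Below, \<open>x j = xs ! (j - 1)\<close> is the \<open>j\<close>-th argument, counted from \<open>1\<close>.\<close>

definition insertion ::
  "('k::field \<Rightarrow> 'v::ab_group_add \<Rightarrow> 'v) \<Rightarrow> ('v \<Rightarrow> 'v) \<Rightarrow> nat \<Rightarrow> nat \<Rightarrow> nat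
     \<Rightarrow> ('v list \<Rightarrow> 'v) \<Rightarrow> ('v list \<Rightarrow> 'v) \<Rightarrow> ('v list \<Rightarrow> 'v)" where
  "insertion scale \<alpha> p q k P Q xs =
     (if length xs = p + q + 1 then
        let x = (\<lambda>j. xs ! (j - 1)) in
        \<Sum>\<sigma>\<in>unshuffles (k - 1) q. scale (of_int (sign \<sigma>))
          (P (map (\<lambda>j. (\<alpha> ^^ q) (x (\<sigma> j))) [1..<k]
              @ [Q (map (\<lambda>j. x (\<sigma> j)) [k..<k + q] @ [x (k + q)])]
              @ map (\<lambda>j. (\<alpha> ^^ q) (x j)) [k + q + 1..<p + q + 2]))
      else 0)"

definition circ ::
  "('k::field \<Rightarrow> 'v::ab_group_add \<Rightarrow> 'v) \<Rightarrow> ('v \<Rightarrow> 'v) \<Rightarrow> nat \<Rightarrow> nat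
     \<Rightarrow> ('v list \<Rightarrow> 'v) \<Rightarrow> ('v list \<Rightarrow> 'v) \<Rightarrow> ('v list \<Rightarrow> 'v)" where
  "circ scale \<alpha> p q P Q xs =
     (\<Sum>k = 1..p + 1. scale ((-1) ^ ((k - 1) * q)) (insertion scale \<alpha> p q k P Q xs))"

definition balavoine_hom ::
  "('k::field \<Rightarrow> 'v::ab_group_add \<Rightarrow> 'v) \<Rightarrow> ('v \<Rightarrow> 'v) \<Rightarrow> nat \<Rightarrow> nat
     \<Rightarrow> ('v list \<Rightarrow> 'v) \<Rightarrow> ('v list \<Rightarrow> 'v) \<Rightarrow> ('v list \<Rightarrow> 'v)" where
  "balavoine_hom scale \<alpha> p q P Q xs =
     circ scale \<alpha> p q P Q xs - scale ((-1) ^ (p * q)) (circ scale \<alpha> q p Q P xs)"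

text \<open>The bracket on the whole direct sum is the bilinear extension of \<open>balavoine_hom\<close>: since
  \<open>balavoine_hom scale \<alpha> p q P Q\<close> evaluates \<open>P\<close> only on lists of length \<open>p + 1\<close> and \<open>Q\<close> only on lists
  of length \<open>q + 1\<close>, it sees only the components of \<open>P\<close> and \<open>Q\<close> of degrees \<open>p\<close> and \<open>q\<close>; so it suffices
  to sum over \<open>p + q + 1 = length xs\<close>.\<close>

definition balavoine ::
  "('k::field \<Rightarrow> 'v::ab_group_add \<Rightarrow> 'v) \<Rightarrow> ('v \<Rightarrow> 'v)
     \<Rightarrow> ('v list \<Rightarrow> 'v) \<Rightarrow> ('v list \<Rightarrow> 'v) \<Rightarrow> ('v list \<Rightarrow> 'v)" where
  "balavoine scale \<alpha> P Q xs =
     (\<Sum>(p, q) \<in> {(p, q). p + q + 1 = length xs}. balavoine_hom scale \<alpha> p q P Q xs)"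

lemma circ_eq_0:
  assumes V: "vector_space scale"
    and P: "P \<in> cochains scale \<alpha> (p + 1)" and Q: "Q \<in> cochains scale \<alpha> (q + 1)"
    and ne: "(p', q') \<noteq> (p, q)"
  shows "circ scale \<alpha> p' q' P Q xs = 0"
proof -
  interpret vector_space scale by fact
  have P_len: "P ys = 0" if "length ys \<noteq> p + 1" for ys
    using P that by (auto simp: cochains_def)
  have Q_len: "Q ys = 0" if "length ys \<noteq> q + 1" for ys
    using Q that by (auto simp: cochains_def)
  have P_zero: "P (ys @ [0] @ zs) = 0" for ys zs
  proof (cases "length (ys @ [0] @ zs) = p + 1")
    case True
    have "\<forall>xs i. length xs = p + 1 \<longrightarrow> i < p + 1 \<longrightarrow> Vector_Spaces.linear scale scale (\<lambda>x. P (xs[i := x]))"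
      using P by (simp add: cochains_def multilinear_def)
    moreover have "length ys < p + 1" using True by simp
    ultimately have "Vector_Spaces.linear scale scale (\<lambda>x. P ((ys @ [0] @ zs)[length ys := x]))"
      using True by blast
    then interpret l: Vector_Spaces.linear scale scale "\<lambda>x. P ((ys @ [0] @ zs)[length ys := x])" .
    show ?thesis using l.zero by simp
  qed (rule P_len)
  have "insertion scale \<alpha> p' q' k P Q xs = 0" if k: "k \<in> {1..p' + 1}" for k
  proof (cases "p' = p")
    case False
    then show ?thesis
      unfolding insertion_def Let_def using k by (auto intro!: sum.neutral simp: P_len scale_zero_right)
  next
    case True
    then have "q' \<noteq> q" using ne by simp
    then have "Q (map f [k..<k + q'] @ [y]) = 0" for f y
      by (intro Q_len) simp
    then show ?thesis
      unfolding insertion_def Let_def by (simp only: P_zero scale_zero_right sum.neutral_const if_cancel)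
  qed
  then show ?thesis by (simp add: circ_def scale_zero_right)
qed

lemma balavoine_homogeneous:
  assumes V: "vector_space scale"
    and P: "P \<in> cochains scale \<alpha> (p + 1)" and Q: "Q \<in> cochains scale \<alpha> (q + 1)"
  shows "balavoine scale \<alpha> P Q = balavoine_hom scale \<alpha> p q P Q"
proof
  fix xs :: "'b list"
  interpret vector_space scale by fact
  let ?S = "{(p', q'). p' + q' + 1 = length xs}"
  have fin: "finite ?S"
    by (rule finite_subset[of _ "{..length xs} \<times> {..length xs}"]) auto
  have off: "balavoine_hom scale \<alpha> p' q' P Q xs = 0" if "(p', q') \<noteq> (p, q)" for p' q'
    using that circ_eq_0[OF V P Q, of p' q'] circ_eq_0[OF V Q P, of q' p']
    by (auto simp: balavoine_hom_def scale_zero_right)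
  show "balavoine scale \<alpha> P Q xs = balavoine_hom scale \<alpha> p q P Q xs"
  proof (cases "(p, q) \<in> ?S")
    case True
    then have "balavoine scale \<alpha> P Q xs = (\<Sum>(p', q') \<in> {(p, q)}. balavoine_hom scale \<alpha> p' q' P Q xs)"
      unfolding balavoine_def using off fin by (intro sum.mono_neutral_right) auto
    then show ?thesis by simp
  next
    case False
    then have "balavoine_hom scale \<alpha> p q P Q xs = 0"
      by (simp add: balavoine_hom_def circ_def insertion_def scale_zero_right add.commute)
    moreover have "balavoine scale \<alpha> P Q xs = 0"
      unfolding balavoine_def using False off by (intro sum.neutral) auto
    ultimately show ?thesis by simp
  qed
qed

end

theory Submission
  imports Defs
begin

text \<open>For \<open>P, Q\<close> of degree \<open>1\<close>, expanding the shuffles shows that \<open>- (P \<circ> Q)(x, y, z)\<close> is the defect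
  \<open>P(\<alpha> x, Q(y, z)) - P(Q(x, y), \<alpha> z) - P(\<alpha> y, Q(x, z))\<close>, and \<open>[P, Q]\<^sub>B = P \<circ> Q + Q \<circ> P\<close>. Hence, in
  characteristic \<open>0\<close>, \<open>[P, P]\<^sub>B = 2 P \<circ> P\<close> vanishes iff \<open>P\<close> satisfies the Hom-Leibniz identity, and
  \<open>[P, Q]\<^sub>B = 0\<close> is exactly the compatibility condition.\<close>

lemma unshuffles_0_1: "unshuffles 0 1 = {id}"
  by (auto simp: unshuffles_def strict_mono_on_def)

text \<open>Both blocks are singletons, so monotonicity is vacuous and every permutation of two
  points qualifies.\<close>

lemma unshuffles_1_1: "unshuffles 1 1 = {id, transpose 1 2}"
proof -
  have "{1..1 + 1} = {1, 2::nat}" by auto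
  then show ?thesis
    by (auto simp: unshuffles_def permutes_doubleton_iff strict_mono_on_def)
qed

context vector_space
begin

lemma circ_1_1:
  "circ scale \<alpha> 1 1 P Q [x, y, z] =
     P [Q [x, y], \<alpha> z] - (P [\<alpha> x, Q [y, z]] - P [\<alpha> y, Q [x, z]])"
proof -
  have "insertion scale \<alpha> 1 1 1 P Q [x, y, z] = P [Q [x, y], \<alpha> z]"
    unfolding insertion_def Let_def using unshuffles_0_1
    by (simp add: upt_rec numeral_eq_Suc)
  moreover have "insertion scale \<alpha> 1 1 2 P Q [x, y, z] = P [\<alpha> x, Q [y, z]] - P [\<alpha> y, Q [x, z]]"
  proof -
    \<comment> \<open>Distinctness lets the sum over the two shuffles split; the transposition, of
      sign -1, swaps x and y.\<close>
    have neq: "id \<noteq> transpose 1 (2::nat)"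
      by (metis id_apply one_eq_numeral_iff semiring_norm(85) transpose_apply_first)
    show ?thesis
      unfolding insertion_def Let_def using unshuffles_1_1 neq
      by (simp add: upt_rec sign_swap_id)
  qed
  moreover have "{1..1 + 1} = {1, 2::nat}" by auto
  ultimately show ?thesis
    by (simp add: circ_def)
qed

text \<open>By homogeneity only p = q = 1 contributes, and there the sign
  \<open>(-1) ^ (p * q)\<close> is -1, which turns the difference in the bracket into a sum.\<close>

lemma balavoine_cochains_2:
  assumes "P \<in> cochains scale \<alpha> 2" and "Q \<in> cochains scale \<alpha> 2"
  shows "balavoine scale \<alpha> P Q = (\<lambda>xs. circ scale \<alpha> 1 1 P Q xs + circ scale \<alpha> 1 1 Q P xs)"
  using balavoine_homogeneous[OF vector_space_axioms, of P \<alpha> 1 Q 1] assms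
  by (simp add: balavoine_hom_def fun_eq_iff numeral_2_eq_2)

lemma balavoine_cochains_2_eq_0_iff:
  assumes "P \<in> cochains scale \<alpha> 2" and "Q \<in> cochains scale \<alpha> 2"
  shows "balavoine scale \<alpha> P Q = 0 \<longleftrightarrow>
    (\<forall>x y z. P [\<alpha> x, Q [y, z]] + Q [\<alpha> x, P [y, z]] =
       P [Q [x, y], \<alpha> z] + Q [P [x, y], \<alpha> z] + P [\<alpha> y, Q [x, z]] + Q [\<alpha> y, P [x, z]])"
proof -
  \<comment> \<open>Off length 3, \<open>insertion\<close> is 0 by convention, so vanishing as a
    function can be tested on triples.\<close>
  have len: "balavoine scale \<alpha> P Q xs = 0" if "length xs \<noteq> 3" for xs
    using that by (simp add: balavoine_cochains_2[OF assms] circ_def insertion_def)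
  have "balavoine scale \<alpha> P Q = 0 \<longleftrightarrow> (\<forall>x y z. balavoine scale \<alpha> P Q [x, y, z] = 0)"
  proof
    assume *: "\<forall>x y z. balavoine scale \<alpha> P Q [x, y, z] = 0"
    show "balavoine scale \<alpha> P Q = 0"
    proof
      fix xs
      show "balavoine scale \<alpha> P Q xs = 0 xs"
      proof (cases "length xs = 3")
        case True
        then obtain x y z where "xs = [x, y, z]"
          by (auto simp: numeral_3_eq_3 length_Suc_conv)
        with * show ?thesis by simp
      qed (simp add: len)
    qed
  qed simp
  also have "\<dots> \<longleftrightarrow> (\<forall>x y z. P [\<alpha> x, Q [y, z]] + Q [\<alpha> x, P [y, z]] =
       P [Q [x, y], \<alpha> z] + Q [P [x, y], \<alpha> z] + P [\<alpha> y, Q [x, z]] + Q [\<alpha> y, P [x, z]])"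
    unfolding balavoine_cochains_2[OF assms] circ_1_1
    by (intro arg_cong[where f = All] ext) (auto simp: algebra_simps)
  finally show ?thesis .
qed

text \<open>Cancels the factor 2 that appears when both arguments of the bracket coincide.\<close>

lemma double_eq_double_iff:
  fixes a b :: 'b
  assumes "(2::'a) \<noteq> 0"
  shows "a + a = b + b \<longleftrightarrow> a = b"
  using assms scale_left_distrib[of 1 1 a] scale_left_distrib[of 1 1 b]
  by (metis one_add_one scale_left_imp_eq scale_one)

end

text \<open>Membership in \<open>cochains\<close> already supplies bilinearity and multiplicativity,
  so only the Hom-Leibniz identity is left to compare.\<close>

lemma hom_leibniz_algebra_iff_balavoine:
  fixes scale :: "'k::field_char_0 \<Rightarrow> 'v::ab_group_add \<Rightarrow> 'v"
  assumes "vector_space scale" and lin: "Vector_Spaces.linear scale scale \<alpha>"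
    and P: "P \<in> cochains scale \<alpha> 2"
  shows "hom_leibniz_algebra scale (\<lambda>x y. P [x, y]) \<alpha> \<longleftrightarrow> balavoine scale \<alpha> P P = 0"
proof -
  interpret vector_space scale by fact
  have ml: "Vector_Spaces.linear scale scale (\<lambda>x. P (xs[i := x]))"
    if "length xs = 2" "i < 2" for xs i
    using P that by (simp add: cochains_def multilinear_def)
  \<comment> \<open>Updating \<open>[y, y]\<close> at index 0 or 1 yields the two partial
    maps.\<close>
  have "Vector_Spaces.linear scale scale (\<lambda>x. P [x, y])"
    and "Vector_Spaces.linear scale scale (\<lambda>x. P [y, x])" for y
    using ml[of "[y, y]" 0] ml[of "[y, y]" 1] by simp_all
  moreover have "\<alpha> (P [x, y]) = P [\<alpha> x, \<alpha> y]" for x y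
    using P by (simp add: cochains_def)
  ultimately have "hom_leibniz_algebra scale (\<lambda>x y. P [x, y]) \<alpha> \<longleftrightarrow>
      (\<forall>x y z. P [\<alpha> x, P [y, z]] = P [P [x, y], \<alpha> z] + P [\<alpha> y, P [x, z]])"
    using lin vector_space_axioms
    by (simp add: hom_leibniz_algebra_def hom_leibniz_algebra_axioms_def)
  also have "\<dots> \<longleftrightarrow> balavoine scale \<alpha> P P = 0"
  proof -
    have "P [\<alpha> x, P [y, z]] = P [P [x, y], \<alpha> z] + P [\<alpha> y, P [x, z]] \<longleftrightarrow>
        P [\<alpha> x, P [y, z]] + P [\<alpha> x, P [y, z]] =
        P [P [x, y], \<alpha> z] + P [P [x, y], \<alpha> z] + P [\<alpha> y, P [x, z]] + P [\<alpha> y, P [x, z]]" for x y z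
      using double_eq_double_iff[of "P [\<alpha> x, P [y, z]]" "P [P [x, y], \<alpha> z] + P [\<alpha> y, P [x, z]]"]
      by (simp add: ac_simps)
    then show ?thesis
      unfolding balavoine_cochains_2_eq_0_iff[OF P P] by simp
  qed
  finally show ?thesis .
qed

theorem theorem3p1:
  fixes scale :: "'k::field_char_0 \<Rightarrow> 'v::ab_group_add \<Rightarrow> 'v"
    and \<alpha> :: "'v \<Rightarrow> 'v"
    and \<pi>1 \<pi>2 :: "'v list \<Rightarrow> 'v"
  assumes "vector_space scale"
    and "Vector_Spaces.linear scale scale \<alpha>"
    and "\<pi>1 \<in> cochains scale \<alpha> 2" and "\<pi>2 \<in> cochains scale \<alpha> 2"
  shows "compatible_hom_leibniz_algebra scale (\<lambda>x y. \<pi>1 [x, y]) (\<lambda>x y. \<pi>2 [x, y]) \<alpha> \<longleftrightarrow>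
    bidg_maurer_cartan (cochain_scale scale) (cochain_component scale \<alpha>)
      (balavoine scale \<alpha>) (\<lambda>_. 0) (\<lambda>_. 0) (\<pi>1, \<pi>2)"
proof -
  interpret vector_space scale by fact
  \<comment> \<open>With zero differential, the Maurer-Cartan equation thus loses its factor
    1/2.\<close>
  have half: "cochain_scale scale (1 / 2) f = 0 \<longleftrightarrow> f = 0" for f :: "'v list \<Rightarrow> 'v"
    by (simp add: cochain_scale_def fun_eq_iff)
  \<comment> \<open>Degree is arity minus one.\<close>
  have "\<pi>1 \<in> cochain_component scale \<alpha> 1" "\<pi>2 \<in> cochain_component scale \<alpha> 1"
    using assms(3,4) by (simp_all add: cochain_component_def numeral_2_eq_2)
  then have "bidg_maurer_cartan (cochain_scale scale) (cochain_component scale \<alpha>)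
      (balavoine scale \<alpha>) (\<lambda>_. 0) (\<lambda>_. 0) (\<pi>1, \<pi>2) \<longleftrightarrow>
      balavoine scale \<alpha> \<pi>1 \<pi>1 = 0 \<and> balavoine scale \<alpha> \<pi>2 \<pi>2 = 0 \<and> balavoine scale \<alpha> \<pi>1 \<pi>2 = 0"
    by (simp add: bidg_maurer_cartan_def maurer_cartan_def half)
  \<comment> \<open>The three vanishing brackets match, in order, the two Hom-Leibniz structures and
    the compatibility identity.\<close>
  then show ?thesis
    unfolding compatible_hom_leibniz_algebra_def compatible_hom_leibniz_algebra_axioms_def
      hom_leibniz_algebra_iff_balavoine[OF assms(1,2,3)]
      hom_leibniz_algebra_iff_balavoine[OF assms(1,2,4)]
      balavoine_cochains_2_eq_0_iff[OF assms(3,4)]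
    by simp
qed

end
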